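(* Let $5\le n\le 9$ and put $$a_n=\frac{\sqrt{n-2}}{2\sqrt2},\qquad b_n=\frac12\bigl(6n-12-(n+2)\sqrt{2n-4}\bigr),$$ which are positive constants. Let $$\phi(\rho)=\frac{\rho^2}{a_n\rho^2+b_n},\qquad h(r,t)=\phi\!\left(\frac{r}{\sqrt{-t}}\right)\quad (r\ge 0,\ t<0),$$ and for $x\in\mathbf{R}^n$, $t\in(-\infty,0)$, $1\le i\le n$ define the $so(n)$-valued functions $$A_i(x,t)=-\frac{h(|x|,t)}{|x|^2}\,\sigma_i(x),\qquad (\sigma_i(x))^{\alpha}_{\ \beta}=\delta_i^{\alpha}x^{\beta}-\delta_i^{\beta}x^{\alpha}\quad(1\le\alpha,\beta\le n)$$ (extended continuously to $x=0$). Then $A=A_i\,dx^i$ is a smooth solution of the Yang-Mills heat equation on $\mathbf{R}^n\times(-\infty,0)$, and $$A_i(x,t)=\lambda A_i(\lambda x,\lambda^2t)$$ for all $\lambda>0$; that is, $A$ is a homothetically shrinking soliton.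
   Context: A flow of connections on the trivial $SO(n)$ bundle over Euclidean $\mathbf{R}^n$ is a time-dependent $so(n)$-valued 1-form $A=A_i\,dx^i$ with entries $A^{\alpha}_{i\beta}(x,t)$. Its curvature is $F^{\alpha}_{ij\beta}=\partial_iA^{\alpha}_{j\beta}-\partial_jA^{\alpha}_{i\beta}+A^{\alpha}_{i\gamma}A^{\gamma}_{j\beta}-A^{\alpha}_{j\gamma}A^{\gamma}_{i\beta}$. The Yang-Mills heat equation is $$\frac{\partial}{\partial t}A^{\alpha}_{j\beta}=D_pF^{\alpha}_{pj\beta}=\partial_pF^{\alpha}_{pj\beta}+A^{\alpha}_{p\gamma}F^{\gamma}_{pj\beta}-F^{\alpha}_{pj\gamma}A^{\gamma}_{p\beta},$$ with summation over repeated indices. A homothetically shrinking soliton is a solution of this equation on $\mathbf{R}^n\times(-\infty,0)$ satisfying $A^{\alpha}_{i\beta}(x,t)=\lambda A^{\alpha}_{i\beta}(\lambda x,\lambda^2t)$ for all $\lambda>0$. *)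

theory Defs
  imports "HOL-Analysis.Analysis"
begin

text \<open>A connection on the trivial bundle over Euclidean space is given by matrices
  \<open>A i x t\<close>, where \<open>i\<close> is the form index and the entry with upper (row) index \<open>\<alpha>\<close> and
  lower (column) index \<open>\<beta>\<close> is \<open>A i x t $ \<alpha> $ \<beta>\<close>.  Only the times in the domain of the flow
  are relevant; values at other times are arbitrary.\<close>

type_synonym 'n connection_flow = "'n \<Rightarrow> real^'n \<Rightarrow> real \<Rightarrow> real^'n^'n"

definition so_algebra :: "(real^'n^'n) set" where
  "so_algebra = {M. transpose M = - M}"

text \<open>Smoothness on an open set: all iterated directional derivatives exist, are
  (Frechet) differentiable and continuous.\<close>

fun C_k_on :: "nat \<Rightarrow> 'a::real_normed_vector set \<Rightarrow> ('a \<Rightarrow> 'b::real_normed_vector) \<Rightarrow> bool" where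
  "C_k_on 0 S f \<longleftrightarrow> continuous_on S f"
| "C_k_on (Suc k) S f \<longleftrightarrow>
     (\<forall>z\<in>S. f differentiable (at z)) \<and> (\<forall>v. C_k_on k S (\<lambda>z. frechet_derivative f (at z) v))"

definition smooth_on :: "'a::real_normed_vector set \<Rightarrow> ('a \<Rightarrow> 'b::real_normed_vector) \<Rightarrow> bool" where
  "smooth_on S f \<longleftrightarrow> (\<forall>k. C_k_on k S f)"

definition partial_deriv :: "'n::finite \<Rightarrow> (real^'n \<Rightarrow> 'b::real_normed_vector) \<Rightarrow> real^'n \<Rightarrow> 'b" where
  "partial_deriv i f x = vector_derivative (\<lambda>s. f (x + s *\<^sub>R axis i 1)) (at 0)"

definition curvature ::
  "'n::finite connection_flow \<Rightarrow> 'n \<Rightarrow> 'n \<Rightarrow> real^'n \<Rightarrow> real \<Rightarrow> real^'n^'n" where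
  "curvature A i j x t =
     partial_deriv i (\<lambda>y. A j y t) x - partial_deriv j (\<lambda>y. A i y t) x
     + A i x t ** A j x t - A j x t ** A i x t"

definition div_curvature :: "'n::finite connection_flow \<Rightarrow> 'n \<Rightarrow> real^'n \<Rightarrow> real \<Rightarrow> real^'n^'n" where
  "div_curvature A j x t =
     (\<Sum>p\<in>UNIV. partial_deriv p (\<lambda>y. curvature A p j y t) x
        + A p x t ** curvature A p j x t - curvature A p j x t ** A p x t)"

definition smooth_yang_mills_heat_solution :: "real set \<Rightarrow> 'n::finite connection_flow \<Rightarrow> bool" where
  "smooth_yang_mills_heat_solution T A \<longleftrightarrow>
     (\<forall>i x. \<forall>t\<in>T. A i x t \<in> so_algebra) \<and>
     (\<forall>i. smooth_on (UNIV \<times> T) (\<lambda>(x, t). A i x t)) \<and>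
     (\<forall>j x. \<forall>t\<in>T. ((\<lambda>s. A j x s) has_vector_derivative div_curvature A j x t) (at t))"

definition homothetically_shrinking_soliton :: "'n::finite connection_flow \<Rightarrow> bool" where
  "homothetically_shrinking_soliton A \<longleftrightarrow>
     smooth_yang_mills_heat_solution {..<0} A \<and>
     (\<forall>i x t \<mu>. t < 0 \<and> 0 < \<mu> \<longrightarrow> A i x t = \<mu> *\<^sub>R A i (\<mu> *\<^sub>R x) (\<mu>\<^sup>2 * t))"

definition a_const :: "nat \<Rightarrow> real" where
  "a_const n = sqrt (real n - 2) / (2 * sqrt 2)"

definition b_const :: "nat \<Rightarrow> real" where
  "b_const n = (1 / 2) * (6 * real n - 12 - (real n + 2) * sqrt (2 * real n - 4))"

definition phi :: "nat \<Rightarrow> real \<Rightarrow> real" where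
  "phi n \<rho> = \<rho>\<^sup>2 / (a_const n * \<rho>\<^sup>2 + b_const n)"

definition h_profile :: "nat \<Rightarrow> real \<Rightarrow> real \<Rightarrow> real" where
  "h_profile n r t = phi n (r / sqrt (- t))"

definition sigma :: "'n::finite \<Rightarrow> real^'n \<Rightarrow> real^'n^'n" where
  "sigma i x = (\<chi> \<alpha> \<beta>. (if i = \<alpha> then x $ \<beta> else 0) - (if i = \<beta> then x $ \<alpha> else 0))"

definition soliton_formula :: "'n::finite connection_flow" where
  "soliton_formula i x t =
     - (h_profile CARD('n) (norm x) t / (norm x)\<^sup>2) *\<^sub>R sigma i x"

text \<open>The formula is only meaningful away from the origin; there, the value is the limit.\<close>

definition soliton_connection :: "'n::finite connection_flow" where
  "soliton_connection i x t =
     (if x = 0 then Lim (at 0) (\<lambda>y. soliton_formula i y t) else soliton_formula i x t)"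

end

(* With g = 1 / (a |x|^2 - b t) one has A_i = - g sigma_i, and sigma_i(x) is the wedge product
   of e_i and x, an element of so(n).  The bracket of so(n) gives
     F_ij = (1 - 2 a) g^2 (x_j sigma_i - x_i sigma_j) + (2 g - g^2 |x|^2) sigma_i(e_j),
   and taking the covariant divergence
     D_p F_pj = - g^2 (3 n - 6 - 2 a (n + 2) + (8 a^2 - (n - 2)) g |x|^2) sigma_j.
   Since the time derivative of A_j is - b g^2 sigma_j, the flow equation amounts to
   8 a^2 = n - 2 and b = 3 n - 6 - 2 a (n + 2), which is the choice of a_n and b_n. *)

theory Submission
  imports Defs
begin

section \<open>Smooth functions on open sets\<close>

text \<open>Derivatives at a point of an open set see only values in that set, so agreement passes
  from functions to their directional derivatives and up the recursion. This matters because the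
  soliton has its closed form only for t < 0.\<close>

lemma C_k_on_cong:
  fixes f g :: "'a::real_normed_vector \<Rightarrow> 'b::real_normed_vector"
  assumes "open S" "\<And>z. z \<in> S \<Longrightarrow> f z = g z"
  shows "C_k_on k S f \<longleftrightarrow> C_k_on k S g"
proof -
  have "C_k_on k S g" if "C_k_on k S f" "\<And>z. z \<in> S \<Longrightarrow> f z = g z"
    for f g :: "'a \<Rightarrow> 'b"
    using that
  proof (induction k arbitrary: f g)
    case 0
    then show ?case by (simp cong: continuous_on_cong)
  next
    case (Suc k)
    have d: "g differentiable (at z)" if "z \<in> S" for z
      using Suc.prems that assms(1) unfolding differentiable_def C_k_on.simps
      by (metis has_derivative_transform_within_open)
    have e: "frechet_derivative f (at z) = frechet_derivative g (at z)" if "z \<in> S" for z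
      using Suc.prems that assms(1) by (intro frechet_derivative_transform_within_open[of f z S g]) auto
    show ?case
      using Suc.prems d e Suc.IH by fastforce
  qed
  then show ?thesis using assms(2) by metis
qed

text \<open>Derivatives are unique, so an explicit derivative may replace
  \<open>frechet_derivative\<close>. All closure properties below are reduced to the usual rules of
  differentiation through this rule.\<close>

lemma C_k_on_SucI:
  assumes "open S" "\<And>z. z \<in> S \<Longrightarrow> (f has_derivative f' z) (at z)"
    and "\<And>v. C_k_on k S (\<lambda>z. f' z v)"
  shows "C_k_on (Suc k) S f"
proof -
  have "frechet_derivative f (at z) = f' z" if "z \<in> S" for z
    using assms(2)[OF that] frechet_derivative_at by metis
  then have "C_k_on k S (\<lambda>z. frechet_derivative f (at z) v)" for v
    using assms(3)[of v] C_k_on_cong[OF assms(1), of "\<lambda>z. frechet_derivative f (at z) v" "\<lambda>z. f' z v" k]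
    by simp
  then show ?thesis using assms(2) by (auto simp: differentiable_def)
qed

lemma C_k_on_Suc_derivative:
  assumes "C_k_on (Suc k) S f" "z \<in> S"
  shows "(f has_derivative frechet_derivative f (at z)) (at z)"
  using assms frechet_derivative_works by auto

text \<open>The recursion never states the lower orders; they come from differentiability implying
  continuity at the bottom. The product rule needs this, as it leaves one factor
  undifferentiated.\<close>

lemma C_k_on_Suc_imp: "C_k_on (Suc k) S f \<Longrightarrow> C_k_on k S f"
proof (induction k arbitrary: f)
  case 0
  then show ?case
    by (auto intro!: continuous_at_imp_continuous_on differentiable_imp_continuous_within)
next
  case (Suc k)
  then show ?case by (metis C_k_on.simps(2))
qed

lemma C_k_on_const: "C_k_on k S (\<lambda>z. c)"
proof (induction k arbitrary: c)
  case (Suc k)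
  then show ?case by simp
qed simp

lemma C_k_on_bounded_linear:
  assumes "open S" "bounded_linear f"
  shows "C_k_on k S f"
proof (cases k)
  case 0
  then show ?thesis using assms by (simp add: linear_continuous_on)
next
  case (Suc m)
  show ?thesis unfolding Suc
    by (rule C_k_on_SucI[where f' = "\<lambda>_. f"])
      (auto intro: assms bounded_linear_imp_has_derivative C_k_on_const)
qed

lemma C_k_on_add:
  assumes "open S" "C_k_on k S f" "C_k_on k S g"
  shows "C_k_on k S (\<lambda>z. f z + g z)"
  using assms(2,3)
proof (induction k arbitrary: f g)
  case 0
  then show ?case by (simp add: continuous_on_add)
next
  case (Suc k)
  show ?case
  proof (rule C_k_on_SucI[OF assms(1)])
    fix z assume "z \<in> S"
    then show "((\<lambda>z. f z + g z) has_derivative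
       (\<lambda>v. frechet_derivative f (at z) v + frechet_derivative g (at z) v)) (at z)"
      using Suc.prems by (intro has_derivative_add C_k_on_Suc_derivative)
  next
    fix v
    show "C_k_on k S (\<lambda>z. frechet_derivative f (at z) v + frechet_derivative g (at z) v)"
      using Suc.prems by (intro Suc.IH) auto
  qed
qed

text \<open>Each term of the product rule is again \<open>bil\<close> applied to functions of order
  k, which closes the induction. One statement serves products of reals, inner products and scalar
  multiplication.\<close>

lemma C_k_on_bilinear:
  assumes "open S" "bounded_bilinear bil" "C_k_on k S f" "C_k_on k S g"
  shows "C_k_on k S (\<lambda>z. bil (f z) (g z))"
  using assms(3,4)
proof (induction k arbitrary: f g)
  case 0
  then show ?case using bounded_bilinear.continuous_on[OF assms(2)] by simp
next
  case (Suc k)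
  show ?case
  proof (rule C_k_on_SucI[OF assms(1)])
    fix z assume "z \<in> S"
    then show "((\<lambda>z. bil (f z) (g z)) has_derivative
       (\<lambda>v. bil (f z) (frechet_derivative g (at z) v) + bil (frechet_derivative f (at z) v) (g z))) (at z)"
      using Suc.prems by (intro bounded_bilinear.FDERIV[OF assms(2)] C_k_on_Suc_derivative)
  next
    fix v
    show "C_k_on k S (\<lambda>z. bil (f z) (frechet_derivative g (at z) v) + bil (frechet_derivative f (at z) v) (g z))"
      using Suc.prems C_k_on_Suc_imp[OF Suc.prems(1)] C_k_on_Suc_imp[OF Suc.prems(2)]
      by (intro C_k_on_add[OF assms(1)] Suc.IH) auto
  qed
qed

lemma C_k_on_inverse:
  fixes f :: "'a::real_normed_vector \<Rightarrow> real"
  assumes "open S" "\<And>z. z \<in> S \<Longrightarrow> f z \<noteq> 0" "C_k_on k S f"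
  shows "C_k_on k S (\<lambda>z. inverse (f z))"
  using assms(3)
proof (induction k)
  case 0
  then show ?case using assms(2) by (simp add: continuous_on_inverse)
next
  case (Suc k)
  have inv: "C_k_on k S (\<lambda>z. inverse (f z))"
    using Suc C_k_on_Suc_imp by blast
  show ?case
  proof (rule C_k_on_SucI[OF assms(1)])
    fix z assume "z \<in> S"
    \<comment> \<open>The derivative - f' / f^2 is written as nested products, including the factor
      -1, so that the bilinear rule and the induction hypothesis for 1 / f cover it.\<close>
    then show "((\<lambda>z. inverse (f z)) has_derivative
       (\<lambda>v. (-1) * (inverse (f z) * (frechet_derivative f (at z) v * inverse (f z))))) (at z)"
      using Deriv.has_derivative_inverse[OF assms(2) C_k_on_Suc_derivative[OF Suc.prems]]
      by (simp add: mult.assoc)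
  next
    fix v
    show "C_k_on k S (\<lambda>z. (-1) * (inverse (f z) * (frechet_derivative f (at z) v * inverse (f z))))"
      using Suc.prems inv
      by (intro C_k_on_bilinear[OF assms(1) bounded_bilinear_mult] C_k_on_const) auto
  qed
qed

section \<open>The wedge product of vectors and the matrix commutator\<close>

text \<open>The skew matrix u v^T - v u^T.\<close>

definition wedge :: "real^'n \<Rightarrow> real^'n \<Rightarrow> real^'n^'n" where
  "wedge u v = (\<chi> \<alpha> \<beta>. u $ \<alpha> * v $ \<beta> - v $ \<alpha> * u $ \<beta>)"

text \<open>Named so that, once known to be bounded bilinear, it can be moved through sums and
  scalars.\<close>

definition commutator :: "real^'n^'n \<Rightarrow> real^'n^'n \<Rightarrow> real^'n^'n" where
  "commutator M N = M ** N - N ** M"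

lemma bounded_bilinear_wedge: "bounded_bilinear (wedge :: real^'n::finite \<Rightarrow> _)"
  unfolding bilinear_conv_bounded_bilinear[symmetric] bilinear_def
  by (auto intro!: linearI simp: wedge_def vec_eq_iff algebra_simps)

lemma bounded_bilinear_commutator: "bounded_bilinear (commutator :: real^'n::finite^'n \<Rightarrow> _)"
  unfolding bilinear_conv_bounded_bilinear[symmetric] bilinear_def
  by (auto intro!: linearI simp: commutator_def vec_eq_iff matrix_matrix_mult_def algebra_simps
      sum.distrib sum_distrib_left)

interpretation wedge: bounded_bilinear wedge
  by (rule bounded_bilinear_wedge)

interpretation commutator: bounded_bilinear commutator
  by (rule bounded_bilinear_commutator)

lemma wedge_self [simp]: "wedge u u = 0"
  by (simp add: wedge_def vec_eq_iff)

lemma wedge_commute: "wedge u v = - wedge v u"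
  by (simp add: wedge_def vec_eq_iff)

lemma wedge_in_so_algebra: "wedge u v \<in> so_algebra"
  by (simp add: so_algebra_def transpose_def wedge_def vec_eq_iff)

lemma commutator_self [simp]: "commutator M M = 0"
  by (simp add: commutator_def)

lemma wedge_mult_wedge:
  "(wedge u v ** wedge w z) $ \<alpha> $ \<beta> =
     (v \<bullet> w) * (u $ \<alpha> * z $ \<beta>) - (v \<bullet> z) * (u $ \<alpha> * w $ \<beta>)
     - (u \<bullet> w) * (v $ \<alpha> * z $ \<beta>) + (u \<bullet> z) * (v $ \<alpha> * w $ \<beta>)"
  by (simp add: wedge_def matrix_matrix_mult_def inner_vec_def algebra_simps
      sum.distrib sum_subtractf sum_distrib_left)

text \<open>Both factors are skew, so the reversed product is the transpose of the product.
  Subtracting it turns every dyad of \<open>wedge_mult_wedge\<close> into a wedge.\<close>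

lemma commutator_wedge:
  "commutator (wedge u v) (wedge w z) =
     (v \<bullet> w) *\<^sub>R wedge u z - (v \<bullet> z) *\<^sub>R wedge u w
     - (u \<bullet> w) *\<^sub>R wedge v z + (u \<bullet> z) *\<^sub>R wedge v w"
proof -
  have "commutator (wedge u v) (wedge w z) $ \<alpha> $ \<beta> =
    ((v \<bullet> w) *\<^sub>R wedge u z - (v \<bullet> z) *\<^sub>R wedge u w
     - (u \<bullet> w) *\<^sub>R wedge v z + (u \<bullet> z) *\<^sub>R wedge v w) $ \<alpha> $ \<beta>" for \<alpha> \<beta>
    unfolding commutator_def vector_minus_component wedge_mult_wedge
    by (simp add: wedge_def inner_commute algebra_simps)
  then show ?thesis by (simp add: vec_eq_iff)
qed

section \<open>The matrices \<open>sigma i x\<close> and contractions over their index\<close>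

lemma sigma_eq_wedge: "sigma i x = wedge (axis i 1) x"
  by (auto simp: sigma_def wedge_def vec_eq_iff axis_def)

lemma sum_component_axis: "(\<Sum>p\<in>UNIV. (x $ p) *\<^sub>R axis p 1) = (x :: real^'n::finite)"
  using basis_expansion[of x] by (simp add: scalar_mult_eq_scaleR)

text \<open>Linearity in the first factor and the expansion of x in the standard basis. With y = x
  the contraction vanishes, which removes several terms of the divergence.\<close>

lemma sum_component_sigma: "(\<Sum>p\<in>UNIV. (x $ p) *\<^sub>R sigma p y) = wedge x y"
  unfolding sigma_eq_wedge
  by (simp add: wedge.scaleR_left[symmetric] wedge.sum_left[symmetric] sum_component_axis)

lemma bounded_linear_sigma: "bounded_linear (sigma i)"
  unfolding sigma_eq_wedge by (rule wedge.bounded_linear_right)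

lemma commutator_sigma:
  "commutator (sigma i x) (sigma j x) =
     (x $ j) *\<^sub>R sigma i x - (x $ i) *\<^sub>R sigma j x - (x \<bullet> x) *\<^sub>R sigma i (axis j 1)"
  unfolding sigma_eq_wedge commutator_wedge
  by (simp add: inner_axis inner_commute[of "axis i 1"] wedge_commute[of x])

text \<open>In each bracket the term free of \<open>p\<close> is \<open>sigma j x\<close>, giving n
  copies; the two terms weighted by components contract to one copy each with a minus sign. This is
  the source of n - 2 in the condition on a.\<close>

lemma sum_commutator_sigma_axis:
  "(\<Sum>p\<in>UNIV. commutator (sigma p x) (sigma p (axis j 1))) =
     (real CARD('n) - 2) *\<^sub>R sigma j (x :: real^'n::finite)"
proof -
  have "commutator (sigma p x) (sigma p (axis j 1)) =
      (x $ p) *\<^sub>R sigma p (axis j 1) + sigma j x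
      - (axis j 1 $ p) *\<^sub>R sigma p x" for p
    unfolding sigma_eq_wedge commutator_wedge
    by (simp add: inner_axis wedge_commute[of x] inner_axis_axis) (auto simp: axis_def)
  then show ?thesis
    by (simp add: sum.distrib sum_subtractf sum_component_sigma sum_constant_scaleR del: sum_constant)
      (simp add: sigma_eq_wedge wedge_commute[of x] algebra_simps scaleR_2)
qed

section \<open>Spatial derivatives of the radial ansatz\<close>

lemma partial_deriv_eqI:
  assumes "(f has_derivative f') (at x)"
  shows "partial_deriv i f x = f' (axis i 1)"
proof -
  have "((\<lambda>s. x + s *\<^sub>R axis i 1) has_derivative (\<lambda>s. s *\<^sub>R axis i 1)) (at 0)"
    by (auto intro!: derivative_eq_intros)
  then have "((\<lambda>s. f (x + s *\<^sub>R axis i 1)) has_derivative (\<lambda>s. f' (s *\<^sub>R axis i 1))) (at 0)"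
    using assms has_derivative_compose[of "\<lambda>s. x + s *\<^sub>R axis i 1" _ 0 UNIV f f'] by simp
  moreover have "f' (s *\<^sub>R axis i 1) = s *\<^sub>R f' (axis i 1)" for s
    using assms has_derivative_bounded_linear linear_simps(5) by blast
  ultimately show ?thesis
    unfolding partial_deriv_def
    by (intro vector_derivative_at) (simp add: has_vector_derivative_def)
qed

text \<open>The factor g at a fixed time, with c standing for - b t.\<close>

definition radial :: "real \<Rightarrow> real \<Rightarrow> real^'n \<Rightarrow> real" where
  "radial a c x = inverse (a * (x \<bullet> x) + c)"

text \<open>The derivative is expressed through \<open>radial\<close> itself, so later derivatives
  stay polynomial in g and x.\<close>

lemma has_derivative_radial:
  assumes "0 < a" "0 < c"
  shows "(radial a c has_derivative (\<lambda>v. - 2 * a * (radial a c x)\<^sup>2 * (x \<bullet> v))) (at x)"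
proof -
  have "a * (x \<bullet> x) + c > 0" using assms by (simp add: add_nonneg_pos)
  then show ?thesis
    unfolding radial_def
    by (auto intro!: derivative_eq_intros simp: fun_eq_iff inner_commute power2_eq_square)
qed

lemma has_derivative_sigma [derivative_intros]:
  "(f has_derivative f') (at x) \<Longrightarrow> ((\<lambda>y. sigma i (f y)) has_derivative (\<lambda>v. sigma i (f' v))) (at x)"
  by (rule bounded_linear.has_derivative[OF bounded_linear_sigma])

lemma has_derivative_component [derivative_intros]:
  "(f has_derivative f') (at x) \<Longrightarrow> ((\<lambda>y. f y $ i) has_derivative (\<lambda>v. f' v $ i)) (at x)"
  by (rule bounded_linear.has_derivative[OF bounded_linear_vec_nth])

text \<open>Differentiating g gives the part with 2 a, and differentiating \<open>sigma\<close>
  gives 2 g, since \<open>sigma j (axis i 1)\<close> is antisymmetric in i and j. The remaining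
  terms, with g^2, come from \<open>commutator_sigma\<close>.\<close>

lemma curvature_radial:
  fixes A :: "'n::finite connection_flow"
  assumes "0 < a" "0 < c" and A: "\<And>i x. A i x t = - radial a c x *\<^sub>R sigma i x"
  shows "curvature A i j x t =
     ((1 - 2 * a) * (radial a c x)\<^sup>2) *\<^sub>R ((x $ j) *\<^sub>R sigma i x - (x $ i) *\<^sub>R sigma j x)
     + (2 * radial a c x - (radial a c x)\<^sup>2 * (x \<bullet> x)) *\<^sub>R sigma i (axis j 1)"
proof -
  have d: "partial_deriv p (\<lambda>y. A q y t) x =
      (2 * a * (radial a c x)\<^sup>2 * x $ p) *\<^sub>R sigma q x - radial a c x *\<^sub>R sigma q (axis p 1)" for p q
  proof -
    have "((\<lambda>y. A q y t) has_derivative (\<lambda>v. (2 * a * (radial a c x)\<^sup>2 * (x \<bullet> v)) *\<^sub>R sigma q x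
        - radial a c x *\<^sub>R sigma q v)) (at x)"
      unfolding A
      by (rule derivative_eq_intros has_derivative_radial assms refl)+ (simp add: algebra_simps)
    from partial_deriv_eqI[OF this] show ?thesis by (simp add: inner_axis)
  qed
  have swap: "sigma j (axis i 1) = - sigma i (axis j 1)"
    by (simp add: sigma_eq_wedge wedge_commute[of "axis j 1"])
  have "A i x t ** A j x t - A j x t ** A i x t = commutator (A i x t) (A j x t)"
    by (simp add: commutator_def)
  also have "\<dots> = (radial a c x)\<^sup>2 *\<^sub>R
      ((x $ j) *\<^sub>R sigma i x - (x $ i) *\<^sub>R sigma j x - (x \<bullet> x) *\<^sub>R sigma i (axis j 1))"
    unfolding A commutator_sigma[symmetric]
    by (simp add: commutator.scaleR_left commutator.scaleR_right commutator.minus_left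
        commutator.minus_right power2_eq_square)
  finally have c: "A i x t ** A j x t - A j x t ** A i x t = (radial a c x)\<^sup>2 *\<^sub>R
      ((x $ j) *\<^sub>R sigma i x - (x $ i) *\<^sub>R sigma j x - (x \<bullet> x) *\<^sub>R sigma i (axis j 1))" .
  show ?thesis
    \<comment> \<open>Reassociating isolates the difference of the two matrix products, so that
      \<open>c\<close> can rewrite it.\<close>
    unfolding curvature_def d add_diff_eq[symmetric] c swap
    by (simp add: vec_eq_iff algebra_simps)
qed

lemma div_curvature_radial:
  fixes A :: "'n::finite connection_flow"
  assumes "0 < a" "0 < c" and A: "\<And>i x. A i x t = - radial a c x *\<^sub>R sigma i x"
  shows "div_curvature A j x t =
     - ((radial a c x)\<^sup>2 * (3 * real CARD('n) - 6 - 2 * a * (real CARD('n) + 2)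
        + (8 * a\<^sup>2 - (real CARD('n) - 2)) * (radial a c x * (x \<bullet> x)))) *\<^sub>R sigma j x"
proof -
  define g where "g = radial a c x"
  define P where "P = (1 - 2 * a) * g\<^sup>2"
  define Q where "Q = 2 * g - g\<^sup>2 * (x \<bullet> x)"
  \<comment> \<open>The coefficients P and Q of the curvature are radial, so their gradients are
    multiples of x; \<open>P'\<close> and \<open>Q'\<close> are the multipliers.\<close>
  define P' where "P' = - 4 * a * (1 - 2 * a) * g ^ 3"
  define Q' where "Q' = - 4 * a * g\<^sup>2 + 4 * a * g ^ 3 * (x \<bullet> x) - 2 * g\<^sup>2"
  let ?F = "\<lambda>p. P *\<^sub>R ((x $ j) *\<^sub>R sigma p x - (x $ p) *\<^sub>R sigma j x) + Q *\<^sub>R sigma p (axis j 1)"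
  note F = curvature_radial[where A = A, OF assms(1,2) A]
  have dF: "partial_deriv p (\<lambda>y. curvature A p j y t) x =
       (P' * x $ p) *\<^sub>R ((x $ j) *\<^sub>R sigma p x - (x $ p) *\<^sub>R sigma j x)
       + P *\<^sub>R ((axis j 1 $ p) *\<^sub>R sigma p x - sigma j x - (x $ p) *\<^sub>R sigma j (axis p 1))
       + (Q' * x $ p) *\<^sub>R sigma p (axis j 1)" for p
  proof -
    have [simp]: "axis p 1 $ j = (axis j 1 $ p :: real)" "axis p 1 $ p = (1::real)"
      "sigma p (axis p 1) = 0"
      by (auto simp: axis_def sigma_eq_wedge)
    have dP: "((\<lambda>y. (1 - 2 * a) * (radial a c y)\<^sup>2) has_derivative (\<lambda>v. P' * (x \<bullet> v))) (at x)"
      by (rule derivative_eq_intros has_derivative_radial assms refl)+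
        (simp add: P'_def g_def power2_eq_square power3_eq_cube algebra_simps)
    have dQ: "((\<lambda>y. 2 * radial a c y - (radial a c y)\<^sup>2 * (y \<bullet> y)) has_derivative
        (\<lambda>v. Q' * (x \<bullet> v))) (at x)"
      by (rule derivative_eq_intros has_derivative_radial assms refl)+
        (simp add: Q'_def g_def power2_eq_square power3_eq_cube algebra_simps inner_commute)
    have dS: "((\<lambda>y. (y $ j) *\<^sub>R sigma p y - (y $ p) *\<^sub>R sigma j y) has_derivative
        (\<lambda>v. (v $ j) *\<^sub>R sigma p x + (x $ j) *\<^sub>R sigma p v
           - (v $ p) *\<^sub>R sigma j x - (x $ p) *\<^sub>R sigma j v)) (at x)"
      by (rule derivative_eq_intros refl)+ (simp add: algebra_simps)
    have "((\<lambda>y. curvature A p j y t) has_derivative (\<lambda>v.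
       (P *\<^sub>R ((v $ j) *\<^sub>R sigma p x + (x $ j) *\<^sub>R sigma p v
           - (v $ p) *\<^sub>R sigma j x - (x $ p) *\<^sub>R sigma j v)
       + (P' * (x \<bullet> v)) *\<^sub>R ((x $ j) *\<^sub>R sigma p x - (x $ p) *\<^sub>R sigma j x))
       + (Q *\<^sub>R 0 + (Q' * (x \<bullet> v)) *\<^sub>R sigma p (axis j 1)))) (at x)"
      unfolding F P_def Q_def g_def
      by (intro has_derivative_add has_derivative_scaleR has_derivative_const dP dQ dS)
    from partial_deriv_eqI[OF this] show ?thesis by (simp add: inner_axis)
  qed
  \<comment> \<open>The part of the curvature along \<open>sigma p x\<close> commutes with A_p. In
    the other P term the component of x is kept beside \<open>sigma p x\<close>, so that summing
    over \<open>p\<close> gives \<open>wedge x x\<close>.\<close>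
  have comm: "A p x t ** curvature A p j x t - curvature A p j x t ** A p x t
      = - g *\<^sub>R (Q *\<^sub>R commutator (sigma p x) (sigma p (axis j 1))
          - P *\<^sub>R commutator ((x $ p) *\<^sub>R sigma p x) (sigma j x))" for p
  proof -
    have "A p x t ** curvature A p j x t - curvature A p j x t ** A p x t
       = commutator (- g *\<^sub>R sigma p x) (?F p)"
      unfolding commutator_def F A g_def P_def Q_def ..
    also have "\<dots> = - g *\<^sub>R (Q *\<^sub>R commutator (sigma p x) (sigma p (axis j 1))
          - P *\<^sub>R commutator ((x $ p) *\<^sub>R sigma p x) (sigma j x))"
      by (simp add: commutator.scaleR_left commutator.scaleR_right commutator.minus_left
        commutator.minus_right commutator.add_right commutator.diff_right algebra_simps)
    finally show ?thesis .
  qed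
  have rr: "(\<Sum>p\<in>UNIV. x $ p * x $ p) = x \<bullet> x"
    by (simp add: inner_vec_def)
  have s1: "(\<Sum>p\<in>UNIV. (x $ p) *\<^sub>R ((x $ j) *\<^sub>R sigma p x - (x $ p) *\<^sub>R sigma j x))
     = - (x \<bullet> x) *\<^sub>R sigma j x"
  proof -
    have "(\<Sum>p\<in>UNIV. (x $ p) *\<^sub>R ((x $ j) *\<^sub>R sigma p x - (x $ p) *\<^sub>R sigma j x))
      = (\<Sum>p\<in>UNIV. (x $ j) *\<^sub>R ((x $ p) *\<^sub>R sigma p x) - (x $ p * x $ p) *\<^sub>R sigma j x)"
      by (simp add: algebra_simps)
    also have "\<dots> = (x $ j) *\<^sub>R wedge x x - (x \<bullet> x) *\<^sub>R sigma j x"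
      by (simp only: sum_subtractf scaleR_sum_right[symmetric] scaleR_sum_left[symmetric]
          sum_component_sigma rr)
    finally show ?thesis by simp
  qed
  \<comment> \<open>The first and last summands contract to \<open>sigma j x\<close> with opposite
    signs; only the n middle copies survive.\<close>
  have s2: "(\<Sum>p\<in>UNIV. (axis j 1 $ p) *\<^sub>R sigma p x - sigma j x - (x $ p) *\<^sub>R sigma j (axis p 1))
     = - real CARD('n) *\<^sub>R sigma j x"
  proof -
    have "(\<Sum>p\<in>UNIV. (x $ p) *\<^sub>R sigma j (axis p 1)) = sigma j x"
      unfolding sigma_eq_wedge
      by (simp add: wedge.scaleR_right[symmetric] wedge.sum_right[symmetric] sum_component_axis)
    then show ?thesis
      by (simp add: sum_subtractf sum_component_sigma sum_constant_scaleR del: sum_constant)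
        (simp add: sigma_eq_wedge)
  qed
  have s3: "(\<Sum>p\<in>UNIV. (x $ p) *\<^sub>R sigma p (axis j 1)) = - sigma j x"
    unfolding sum_component_sigma by (simp add: sigma_eq_wedge wedge_commute[of x])
  have s4: "(\<Sum>p\<in>UNIV. commutator ((x $ p) *\<^sub>R sigma p x) (sigma j x)) = 0"
    by (simp only: commutator.sum_left[symmetric] sum_component_sigma wedge_self commutator.zero_left)
  have "div_curvature A j x t =
      P' *\<^sub>R (\<Sum>p\<in>UNIV. (x $ p) *\<^sub>R ((x $ j) *\<^sub>R sigma p x - (x $ p) *\<^sub>R sigma j x))
      + P *\<^sub>R (\<Sum>p\<in>UNIV. (axis j 1 $ p) *\<^sub>R sigma p x - sigma j x - (x $ p) *\<^sub>R sigma j (axis p 1))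
      + Q' *\<^sub>R (\<Sum>p\<in>UNIV. (x $ p) *\<^sub>R sigma p (axis j 1))
      - g *\<^sub>R (Q *\<^sub>R (\<Sum>p\<in>UNIV. commutator (sigma p x) (sigma p (axis j 1)))
          - P *\<^sub>R (\<Sum>p\<in>UNIV. commutator ((x $ p) *\<^sub>R sigma p x) (sigma j x)))"
    unfolding div_curvature_def add_diff_eq[symmetric] comm dF
    by (simp only: scaleR_sum_right sum.distrib[symmetric] sum_subtractf[symmetric] scaleR_scaleR
        scaleR_minus_left diff_conv_add_uminus[symmetric] add_diff_eq)
  also have "\<dots> = (- P' * (x \<bullet> x) - P * real CARD('n) - Q' - g * Q * (real CARD('n) - 2)) *\<^sub>R sigma j x"
    unfolding s1 s2 s3 s4 sum_commutator_sigma_axis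
    by (simp add: algebra_simps)
  \<comment> \<open>The terms 4 a g^3 |x|^2 from \<open>P'\<close> and \<open>Q'\<close> cancel,
    which leaves 8 a^2 from \<open>P'\<close> against n - 2 from the brackets at order g^3.\<close>
  also have "- P' * (x \<bullet> x) - P * real CARD('n) - Q' - g * Q * (real CARD('n) - 2)
    = - (g\<^sup>2 * (3 * real CARD('n) - 6 - 2 * a * (real CARD('n) + 2)
        + (8 * a\<^sup>2 - (real CARD('n) - 2)) * (g * (x \<bullet> x))))"
    unfolding P_def Q_def P'_def Q'_def
    by (simp add: algebra_simps power2_eq_square power3_eq_cube)
  finally show ?thesis unfolding g_def .
qed

section \<open>The soliton\<close>

lemma a_const_square:
  assumes "2 \<le> n"
  shows "8 * (a_const n)\<^sup>2 = real n - 2"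
  using assms by (simp add: a_const_def power_divide power_mult_distrib)

text \<open>The root in \<open>b_const\<close> is 4 a_n, which brings b_n to the form in which it
  appears in the divergence.\<close>

lemma b_const_eq: "b_const n = 3 * real n - 6 - 2 * a_const n * (real n + 2)"
proof -
  have "4 * a_const n = (2 / sqrt 2) * sqrt (real n - 2)"
    by (simp add: a_const_def)
  also have "2 / sqrt 2 = sqrt (2 :: real)"
    by (simp add: real_div_sqrt)
  also have "sqrt 2 * sqrt (real n - 2) = sqrt (2 * real n - 4)"
    by (simp only: real_sqrt_mult[symmetric] right_diff_distrib) simp
  finally have "sqrt (2 * real n - 4) = 4 * a_const n" ..
  then show ?thesis by (simp add: b_const_def algebra_simps)
qed

lemma a_const_pos: "2 < n \<Longrightarrow> 0 < a_const n"
  by (simp add: a_const_def)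

text \<open>Squaring reduces the claim to \<open>(n - 4) (n - 10) < 0\<close>.\<close>

lemma b_const_pos:
  assumes "5 \<le> n" "n \<le> 9"
  shows "0 < b_const n"
proof -
  have "(real n - 4) * (real n - 10) < 0"
    using assms by (intro mult_pos_neg) auto
  then have "(real n + 2)\<^sup>2 < 18 * (real n - 2)"
    by (simp add: power2_eq_square algebra_simps)
  then have "(real n + 2)\<^sup>2 * (2 * (real n - 2)) < 18 * (real n - 2) * (2 * (real n - 2))"
    using assms by (intro mult_strict_right_mono) auto
  moreover have "(real n + 2)\<^sup>2 * (2 * (real n - 2)) = ((real n + 2) * sqrt (2 * real n - 4))\<^sup>2"
    using assms by (simp add: power_mult_distrib)
  moreover have "18 * (real n - 2) * (2 * (real n - 2)) = (6 * real n - 12)\<^sup>2"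
    by (simp add: power2_eq_square algebra_simps)
  ultimately have "((real n + 2) * sqrt (2 * real n - 4))\<^sup>2 < (6 * real n - 12)\<^sup>2"
    by simp
  then have "(real n + 2) * sqrt (2 * real n - 4) < 6 * real n - 12"
    by (rule power_less_imp_less_base) (use assms in simp)
  then show ?thesis by (simp add: b_const_def)
qed

section \<open>Closed form, smoothness and time derivative\<close>

text \<open>Inserting the profile and clearing - t cancels |x|^2 away from the origin. The resulting
  expression is continuous at 0, so the limit taken there is its value.\<close>

lemma soliton_connection_eq_radial:
  fixes x :: "real^'n::finite"
  assumes "0 < a_const CARD('n)" "0 < b_const CARD('n)" "t < 0"
  shows "soliton_connection i x t =
    - radial (a_const CARD('n)) (- b_const CARD('n) * t) x *\<^sub>R sigma i x"
proof -
  define a where "a = a_const CARD('n)"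
  define b where "b = b_const CARD('n)"
  have ab: "0 < a" "0 < b" using assms by (simp_all add: a_def b_def)
  have formula: "soliton_formula i y t = - radial a (- b * t) y *\<^sub>R sigma i y" for y :: "real^'n"
  proof (cases "y = 0")
    \<comment> \<open>Both sides are zero because \<open>sigma i 0\<close> is zero, whatever value
      the division by zero takes.\<close>
    case True
    then show ?thesis by (simp add: soliton_formula_def sigma_eq_wedge wedge.zero_right)
  next
    case False
    have d: "a * (norm y)\<^sup>2 - b * t > 0"
      using ab assms(3) mult_pos_neg[of b t] mult_nonneg_nonneg[of a "(norm y)\<^sup>2"]
      by (simp add: less_le_trans[of _ 0])
    have "phi CARD('n) (norm y / sqrt (- t)) = ((norm y)\<^sup>2 / (- t)) / (a * ((norm y)\<^sup>2 / (- t)) + b)"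
      using assms(3) by (simp add: phi_def a_def b_def power_divide)
    also have "a * ((norm y)\<^sup>2 / (- t)) + b = (a * (norm y)\<^sup>2 - b * t) / (- t)"
      using assms(3) by (simp add: diff_divide_distrib)
    also have "((norm y)\<^sup>2 / (- t)) / \<dots> = (norm y)\<^sup>2 / (a * (norm y)\<^sup>2 - b * t)"
      using assms(3) by simp
    finally have "phi CARD('n) (norm y / sqrt (- t)) / (norm y)\<^sup>2 = inverse (a * (norm y)\<^sup>2 - b * t)"
      using False by (simp add: inverse_eq_divide)
    then show ?thesis
      by (simp add: soliton_formula_def h_profile_def radial_def power2_norm_eq_inner)
  qed
  have "(radial a (- b * t) :: real^'n \<Rightarrow> real) \<midarrow>0\<rightarrow> radial a (- b * t) (0 :: real^'n)"
    using has_derivative_continuous[OF has_derivative_radial[of a "- b * t" "0 :: real^'n"]]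
      ab assms(3) by (simp add: isCont_def mult_pos_neg)
  moreover have "sigma i \<midarrow>0\<rightarrow> sigma i 0"
    using linear_continuous_at[OF bounded_linear_sigma, of 0 i] by (simp add: isCont_def)
  ultimately have "(\<lambda>y. soliton_formula i y t) \<midarrow>0\<rightarrow> - radial a (- b * t) (0 :: real^'n) *\<^sub>R sigma i 0"
    unfolding formula by (intro tendsto_intros)
  then have "Lim (at 0) (\<lambda>y. soliton_formula i y t) = - radial a (- b * t) (0 :: real^'n) *\<^sub>R sigma i 0"
    by (intro tendsto_Lim) auto
  then show ?thesis
    by (simp add: soliton_connection_def formula a_def[symmetric] b_def[symmetric])
qed

text \<open>Jointly in (x, t) the denominator is built from linear maps by bilinear products and a
  sum, and it is positive for t < 0 even at x = 0, so the closure rules apply at every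
  order.\<close>

lemma smooth_on_radial_sigma:
  assumes "0 < a" "0 < b"
  shows "smooth_on (UNIV \<times> {..<0}) (\<lambda>(x, t). - radial a (- b * t) x *\<^sub>R sigma i (x :: (real, 'n::finite) vec))"
  unfolding smooth_on_def
proof
  fix k
  let ?S = "UNIV \<times> {..<0} :: ((real^'n) \<times> real) set"
  have S: "open ?S" by (intro open_Times) auto
  have "C_k_on k ?S (\<lambda>z. fst z \<bullet> fst z)"
    by (intro C_k_on_bilinear[OF S bounded_bilinear_inner] C_k_on_bounded_linear[OF S] bounded_linear_fst)
  note C_k_on_bilinear[OF S bounded_bilinear_mult C_k_on_const this, of a]
  moreover have "C_k_on k ?S (\<lambda>z. (- b) * snd z)"
    by (intro C_k_on_bilinear[OF S bounded_bilinear_mult] C_k_on_const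
        C_k_on_bounded_linear[OF S] bounded_linear_snd)
  ultimately have "C_k_on k ?S (\<lambda>z. a * (fst z \<bullet> fst z) + (- b) * snd z)"
    by (rule C_k_on_add[OF S])
  moreover have "a * (fst z \<bullet> fst z) + (- b) * snd z \<noteq> 0" if "z \<in> ?S" for z
    using that assms add_nonneg_pos[of "a * (fst z \<bullet> fst z)" "(- b) * snd z"]
    by (auto simp: mult_pos_neg)
  ultimately have inv: "C_k_on k ?S (\<lambda>z. inverse (a * (fst z \<bullet> fst z) + (- b) * snd z))"
    by (intro C_k_on_inverse[OF S])
  have "C_k_on k ?S (\<lambda>z. sigma i (fst z))"
    by (intro C_k_on_bounded_linear[OF S] bounded_linear_compose[OF bounded_linear_sigma bounded_linear_fst])
  from C_k_on_bilinear[OF S bounded_bilinear_scaleR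
      C_k_on_bilinear[OF S bounded_bilinear_mult C_k_on_const inv, of "- 1"] this]
  show "C_k_on k ?S (\<lambda>(x, t). - radial a (- b * t) x *\<^sub>R sigma i x)"
    by (simp add: case_prod_unfold radial_def)
qed

lemma has_vector_derivative_radial_sigma:
  assumes "0 < a" "0 < b" "t < 0"
  shows "((\<lambda>s. - radial a (- b * s) x *\<^sub>R sigma j x) has_vector_derivative
     - (b * (radial a (- b * t) x)\<^sup>2) *\<^sub>R sigma j x) (at t)"
proof -
  have "a * (x \<bullet> x) + - b * t > 0"
    using assms by (intro add_nonneg_pos) (auto simp: mult_pos_neg)
  then have "((\<lambda>s. - radial a (- b * s) x) has_vector_derivative
      - (b * (radial a (- b * t) x)\<^sup>2)) (at t)"
    unfolding radial_def has_real_derivative_iff_has_vector_derivative[symmetric]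
    by (auto intro!: derivative_eq_intros simp: power2_eq_square)
  then show ?thesis
    by (rule bounded_linear.has_vector_derivative[OF bounded_linear_scaleR_left])
qed

theorem mainTheorem2:
  assumes "5 \<le> CARD('n::finite)" and "CARD('n) \<le> 9"
  shows "0 < a_const CARD('n) \<and> 0 < b_const CARD('n) \<and>
         homothetically_shrinking_soliton (soliton_connection :: 'n connection_flow)"
proof -
  define a where "a = a_const CARD('n)"
  define b where "b = b_const CARD('n)"
  let ?A = "soliton_connection :: 'n connection_flow"
  have a: "0 < a" and b: "0 < b"
    using assms by (simp_all add: a_def b_def a_const_pos b_const_pos)
  have A: "?A i x t = - radial a (- b * t) x *\<^sub>R sigma i x" if "t < 0" for i x t
    using soliton_connection_eq_radial a b that unfolding a_def b_def by blast
  have "?A i x t \<in> so_algebra" if "t < 0" for i x t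
    unfolding A[OF that] sigma_eq_wedge wedge.scaleR_left[symmetric] by (rule wedge_in_so_algebra)
  moreover have "smooth_on (UNIV \<times> {..<0}) (\<lambda>(x, t). ?A i x t)" for i
  proof -
    have "C_k_on k (UNIV \<times> {..<0}) (\<lambda>(x, t). ?A i x t) \<longleftrightarrow>
        C_k_on k (UNIV \<times> {..<0}) (\<lambda>(x, t). - radial a (- b * t) x *\<^sub>R sigma i x)" for k
      by (rule C_k_on_cong) (auto simp: open_Times A)
    then show ?thesis
      using smooth_on_radial_sigma[OF a b, of i] by (simp add: smooth_on_def)
  qed
  moreover have "((\<lambda>s. ?A j x s) has_vector_derivative div_curvature ?A j x t) (at t)"
    if "t < 0" for j x t
  proof -
    \<comment> \<open>The choice of a_n removes the term with g |x|^2 from the divergence; what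
      remains is b_n, matching the time derivative.\<close>
    have "8 * a\<^sup>2 - (real CARD('n) - 2) = 0"
      using a_const_square[of "CARD('n)"] assms by (simp add: a_def)
    moreover have "3 * real CARD('n) - 6 - 2 * a * (real CARD('n) + 2) = b"
      by (simp add: a_def b_def b_const_eq)
    ultimately have "div_curvature ?A j x t = - (b * (radial a (- b * t) x)\<^sup>2) *\<^sub>R sigma j x"
      using div_curvature_radial[where A = ?A, OF a _ A[OF that], of j x] b that
      by (simp add: mult_pos_neg mult.commute)
    then show ?thesis
      \<comment> \<open>The closed form holds on the open half-line of negative times, which
        suffices for the derivative at t.\<close>
      using has_vector_derivative_transform_within_open[OF has_vector_derivative_radial_sigma[OF a b that],
          of "{..<0}" x j "\<lambda>s. ?A j x s"] that by (simp add: A)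
  qed
  moreover have "?A i x t = \<mu> *\<^sub>R ?A i (\<mu> *\<^sub>R x) (\<mu>\<^sup>2 * t)" if "t < 0" "0 < \<mu>" for i x t \<mu>
  proof -
    have "\<mu>\<^sup>2 * t < 0" using that by (simp add: mult_pos_neg)
    \<comment> \<open>The denominator scales by \<mu>^2 under parabolic scaling; this cancels one
      \<mu> from the linear \<open>sigma\<close> and the prefactor \<mu>.\<close>
    have "a * (\<mu> *\<^sub>R x \<bullet> \<mu> *\<^sub>R x) + - b * (\<mu>\<^sup>2 * t) = \<mu>\<^sup>2 * (a * (x \<bullet> x) + - b * t)"
      by (simp add: power2_eq_square algebra_simps)
    then have "radial a (- b * (\<mu>\<^sup>2 * t)) (\<mu> *\<^sub>R x) = inverse (\<mu>\<^sup>2) * radial a (- b * t) x"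
      unfolding radial_def by (simp only: inverse_mult_distrib)
    then show ?thesis
      unfolding A[OF \<open>t < 0\<close>] A[OF \<open>\<mu>\<^sup>2 * t < 0\<close>] sigma_eq_wedge wedge.scaleR_right
      using that by (simp add: power2_eq_square field_simps)
  qed
  ultimately have "homothetically_shrinking_soliton ?A"
    by (simp add: homothetically_shrinking_soliton_def smooth_yang_mills_heat_solution_def)
  then show ?thesis using a b by (simp add: a_def b_def)
qed

end
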